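(* Let $\mathcal{G}=\begin{pmatrix}\mathcal{A}&\mathcal{M}\\ \mathcal{N}&\mathcal{B}\end{pmatrix}$ be a generalized matrix algebra whose modules $\mathcal{M}$ and $\mathcal{N}$ are $2$-torsion free, and let $\mathcal{L}:\mathcal{G}\to\mathcal{G}$ be a Lie derivation, written in its standard presentation with data $(m_0,n_0,P,Q,f,g,h_{\mathcal{A}},h_{\mathcal{B}})$ (recalled in the context). If $\mathcal{L}$ is proper, then (A') $h_{\mathcal{A}}(\mathcal{A})\subseteq\pi_{\mathcal{B}}(Z(\mathcal{G}))$ and $h_{\mathcal{B}}(\mathcal{B})\subseteq\pi_{\mathcal{A}}(Z(\mathcal{G}))$, and (B') $h_{\mathcal{B}}(nm)\oplus h_{\mathcal{A}}(mn)\in Z(\mathcal{G})$ for all $m\in\mathcal{M}$, $n\in\mathcal{N}$. The converse holds when $\mathcal{M}$ is faithful: if $\mathcal{M}$ is a faithful $(\mathcal{A},\mathcal{B})$-module and (A') and (B') hold, then $\mathcal{L}$ is proper.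
   Context: All algebras are unital algebras over a fixed commutative unital ring $\mathbf{R}$; linear means $\mathbf{R}$-linear; $Z(\cdot)$ denotes the center; $[a,b]=ab-ba$. A module $\mathcal{M}$ is $2$-torsion free if $2m=0$ implies $m=0$ for $m\in\mathcal{M}$. Generalized matrix algebra: a Morita context consists of unital algebras $\mathcal{A},\mathcal{B}$, an $(\mathcal{A},\mathcal{B})$-bimodule $\mathcal{M}$, a $(\mathcal{B},\mathcal{A})$-bimodule $\mathcal{N}$, and bimodule homomorphisms $\Phi:\mathcal{M}\otimes_{\mathcal{B}}\mathcal{N}\to\mathcal{A}$, $\Psi:\mathcal{N}\otimes_{\mathcal{A}}\mathcal{M}\to\mathcal{B}$ such that, writing $mn=\Phi(m\otimes n)$ and $nm=\Psi(n\otimes m)$, one has $(mn)m'=m(nm')$ and $(nm)n'=n(mn')$ for all $m,m'\in\mathcal{M}$, $n,n'\in\mathcal{N}$. Then the set $\mathcal{G}$ of matrices $\begin{pmatrix}a&m\\ n&b\end{pmatrix}$ ($a\in\mathcal{A}$, $m\in\mathcal{M}$, $n\in\mathcal{N}$, $b\in\mathcal{B}$), with the usual matrix operations, is an algebra, called a generalized matrix algebra; it is assumed that at least one of $\mathcal{M},\mathcal{N}$ is nonzero. Write $a\oplus b=\begin{pmatrix}a&0\\0&b\end{pmatrix}\in\mathcal{G}$. The center is $Z(\mathcal{G})=\{a\oplus b: a\in Z(\mathcal{A}),\,b\in Z(\mathcal{B}),\ am=mb,\ na=bn\ \text{for all } m\in\mathcal{M},n\in\mathcal{N}\}$. The projections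 $\pi_{\mathcal{A}}:\mathcal{G}\to\mathcal{A}$ and $\pi_{\mathcal{B}}:\mathcal{G}\to\mathcal{B}$ send $\begin{pmatrix}a&m\\ n&b\end{pmatrix}$ to $a$ and to $b$, respectively. $\mathcal{M}$ is a faithful $(\mathcal{A},\mathcal{B})$-module if $a\mathcal{M}=0$ implies $a=0$ (for $a\in\mathcal{A}$) and $\mathcal{M}b=0$ implies $b=0$ (for $b\in\mathcal{B}$). A derivation of an algebra $\mathcal{C}$ is a linear map $\mathcal{D}:\mathcal{C}\to\mathcal{C}$ with $\mathcal{D}(xy)=\mathcal{D}(x)y+x\mathcal{D}(y)$. A Lie derivation is a linear map $\mathcal{L}:\mathcal{C}\to\mathcal{C}$ with $\mathcal{L}([x,y])=[\mathcal{L}(x),y]+[x,\mathcal{L}(y)]$. A Lie derivation $\mathcal{L}$ is proper if $\mathcal{L}=\mathcal{D}+\tau$ with $\mathcal{D}:\mathcal{C}\to\mathcal{C}$ a derivation and $\tau:\mathcal{C}\to Z(\mathcal{C})$ linear. Standard presentation of a Lie derivation (known fact): a linear map $\mathcal{L}$ on $\mathcal{G}$ is a Lie derivation if and only if $$\mathcal{L}\begin{pmatrix}a&m\\ n&b\end{pmatrix}=\begin{pmatrix}P(a)-mn_0-m_0n+h_{\mathcal{B}}(b)& am_0-m_0b+f(m)\\ n_0a-bn_0+g(n)& h_{\mathcal{A}}(a)+n_0m+nm_0+Q(b)\end{pmatrix}$$ for some $m_0\in\mathcal{M}$, $n_0\in\mathcal{N}$ and linear maps $P:\mathcal{A}\to\mathcal{A}$,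 $Q:\mathcal{B}\to\mathcal{B}$, $f:\mathcal{M}\to\mathcal{M}$, $g:\mathcal{N}\to\mathcal{N}$, $h_{\mathcal{B}}:\mathcal{B}\to Z(\mathcal{A})$, $h_{\mathcal{A}}:\mathcal{A}\to Z(\mathcal{B})$ such that, for all $a,a'\in\mathcal{A}$, $b,b'\in\mathcal{B}$, $m\in\mathcal{M}$, $n\in\mathcal{N}$: (a) $P,Q$ are Lie derivations; (b) $h_{\mathcal{B}}([b,b'])=0$ and $h_{\mathcal{A}}([a,a'])=0$; (c) $f(am)=P(a)m-mh_{\mathcal{A}}(a)+af(m)$ and $f(mb)=mQ(b)-h_{\mathcal{B}}(b)m+f(m)b$; (d) $g(na)=nP(a)-h_{\mathcal{A}}(a)n+g(n)a$ and $g(bn)=Q(b)n-nh_{\mathcal{B}}(b)+bg(n)$; (e) $P(mn)-h_{\mathcal{B}}(nm)=mg(n)+f(m)n$ and $Q(nm)-h_{\mathcal{A}}(mn)=g(n)m+nf(m)$. *)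

theory Defs
  imports Complex_Main "HOL-Library.Product_Plus"
begin

section \<open>Algebras over a commutative ring, derivations and Lie derivations\<close>

text \<open>
  The multiplication is an explicit parameter, because the multiplication of a generalized
  matrix algebra depends on the Morita context and so cannot come from a type class.
\<close>

locale unital_algebra = module scale
  for scale :: "'r::comm_ring_1 \<Rightarrow> 'c::ab_group_add \<Rightarrow> 'c" +
  fixes mul :: "'c \<Rightarrow> 'c \<Rightarrow> 'c" and unit :: 'c
  assumes mul_assoc: "mul (mul x y) z = mul x (mul y z)"
    and mul_add_left: "mul (x + y) z = mul x z + mul y z"
    and mul_add_right: "mul x (y + z) = mul x y + mul x z"
    and mul_unit_left: "mul unit x = x"
    and mul_unit_right: "mul x unit = x"
    and mul_scale_left: "mul (scale r x) y = scale r (mul x y)"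
    and mul_scale_right: "mul x (scale r y) = scale r (mul x y)"

definition commutator :: "('c::ab_group_add \<Rightarrow> 'c \<Rightarrow> 'c) \<Rightarrow> 'c \<Rightarrow> 'c \<Rightarrow> 'c" where
  "commutator mul x y = mul x y - mul y x"

definition center :: "('c \<Rightarrow> 'c \<Rightarrow> 'c) \<Rightarrow> 'c set" where
  "center mul = {z. \<forall>x. mul z x = mul x z}"

definition derivation ::
  "('r::comm_ring_1 \<Rightarrow> 'c::ab_group_add \<Rightarrow> 'c) \<Rightarrow> ('c \<Rightarrow> 'c \<Rightarrow> 'c) \<Rightarrow> ('c \<Rightarrow> 'c) \<Rightarrow> bool" where
  "derivation scale mul D \<longleftrightarrow>
     module_hom scale scale D \<and> (\<forall>x y. D (mul x y) = mul (D x) y + mul x (D y))"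

definition lie_derivation ::
  "('r::comm_ring_1 \<Rightarrow> 'c::ab_group_add \<Rightarrow> 'c) \<Rightarrow> ('c \<Rightarrow> 'c \<Rightarrow> 'c) \<Rightarrow> ('c \<Rightarrow> 'c) \<Rightarrow> bool" where
  "lie_derivation scale mul L \<longleftrightarrow>
     module_hom scale scale L \<and>
     (\<forall>x y. L (commutator mul x y) = commutator mul (L x) y + commutator mul x (L y))"

definition proper_lie_derivation ::
  "('r::comm_ring_1 \<Rightarrow> 'c::ab_group_add \<Rightarrow> 'c) \<Rightarrow> ('c \<Rightarrow> 'c \<Rightarrow> 'c) \<Rightarrow> ('c \<Rightarrow> 'c) \<Rightarrow> bool" where
  "proper_lie_derivation scale mul L \<longleftrightarrow>
     lie_derivation scale mul L \<and>
     (\<exists>D \<tau>. derivation scale mul D \<and>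
        module_hom scale scale \<tau> \<and> range \<tau> \<subseteq> center mul \<and>
        (\<forall>x. L x = D x + \<tau> x))"


section \<open>Morita contexts and generalized matrix algebras\<close>

locale bimodule =
  A: unital_algebra sA "(*)" 1 + B: unital_algebra sB "(*)" 1 + module sM
  for sA :: "'r::comm_ring_1 \<Rightarrow> 'a::ring_1 \<Rightarrow> 'a"
    and sB :: "'r \<Rightarrow> 'b::ring_1 \<Rightarrow> 'b"
    and sM :: "'r \<Rightarrow> 'm::ab_group_add \<Rightarrow> 'm" +
  fixes lact :: "'a \<Rightarrow> 'm \<Rightarrow> 'm" and ract :: "'m \<Rightarrow> 'b \<Rightarrow> 'm"
  assumes lact_add_left: "lact (a + a') m = lact a m + lact a' m"
    and lact_add_right: "lact a (m + m') = lact a m + lact a m'"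
    and lact_one: "lact 1 m = m"
    and lact_assoc: "lact (a * a') m = lact a (lact a' m)"
    and ract_add_left: "ract (m + m') b = ract m b + ract m' b"
    and ract_add_right: "ract m (b + b') = ract m b + ract m b'"
    and ract_one: "ract m 1 = m"
    and ract_assoc: "ract m (b * b') = ract (ract m b) b'"
    and lact_ract: "ract (lact a m) b = lact a (ract m b)"
    and lact_scale_left: "lact (sA r a) m = sM r (lact a m)"
    and lact_scale_right: "lact a (sM r m) = sM r (lact a m)"
    and ract_scale_left: "ract (sM r m) b = sM r (ract m b)"
    and ract_scale_right: "ract m (sB r b) = sM r (ract m b)"

record ('r, 'a, 'b, 'm, 'n) morita_data =
  scaleA :: "'r \<Rightarrow> 'a \<Rightarrow> 'a"
  scaleB :: "'r \<Rightarrow> 'b \<Rightarrow> 'b"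
  scaleM :: "'r \<Rightarrow> 'm \<Rightarrow> 'm"
  scaleN :: "'r \<Rightarrow> 'n \<Rightarrow> 'n"
  actAM :: "'a \<Rightarrow> 'm \<Rightarrow> 'm"
  actMB :: "'m \<Rightarrow> 'b \<Rightarrow> 'm"
  actBN :: "'b \<Rightarrow> 'n \<Rightarrow> 'n"
  actNA :: "'n \<Rightarrow> 'a \<Rightarrow> 'n"
  pairMN :: "'m \<Rightarrow> 'n \<Rightarrow> 'a"
  pairNM :: "'n \<Rightarrow> 'm \<Rightarrow> 'b"

text \<open>
  The bimodule homomorphism \<open>\<Phi> : M \<otimes>\<^sub>B N \<rightarrow> A\<close> is given through the
  universal property of the tensor product, as the biadditive \<open>B\<close>-balanced map
  \<open>(m, n) \<mapsto> \<Phi> (m \<otimes> n) = mn\<close> that commutes with the outer actions of \<open>A\<close>; likewise \<open>\<Psi>\<close>.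
  \<open>R\<close>-linearity of these maps follows from compatibility with the actions.

  The classes \<open>ring_1\<close> and \<open>comm_ring_1\<close> entail \<open>0 \<noteq> 1\<close>.  No generality is lost: the actions
  are unital, so if \<open>R\<close>, \<open>A\<close> or \<open>B\<close> were the zero ring, then both \<open>M\<close> and \<open>N\<close> would be zero,
  which is ruled out for a generalized matrix algebra.
\<close>

locale morita_context =
  M: bimodule "scaleA G" "scaleB G" "scaleM G" "actAM G" "actMB G" +
  N: bimodule "scaleB G" "scaleA G" "scaleN G" "actBN G" "actNA G"
  for G :: "('r::comm_ring_1, 'a::ring_1, 'b::ring_1,
             'm::ab_group_add, 'n::ab_group_add) morita_data" +
  assumes pairMN_add_left: "pairMN G (m + m') n = pairMN G m n + pairMN G m' n"
    and pairMN_add_right: "pairMN G m (n + n') = pairMN G m n + pairMN G m n'"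
    and pairMN_balanced: "pairMN G (actMB G m b) n = pairMN G m (actBN G b n)"
    and pairMN_left: "pairMN G (actAM G a m) n = a * pairMN G m n"
    and pairMN_right: "pairMN G m (actNA G n a) = pairMN G m n * a"
    and pairNM_add_left: "pairNM G (n + n') m = pairNM G n m + pairNM G n' m"
    and pairNM_add_right: "pairNM G n (m + m') = pairNM G n m + pairNM G n m'"
    and pairNM_balanced: "pairNM G (actNA G n a) m = pairNM G n (actAM G a m)"
    and pairNM_left: "pairNM G (actBN G b n) m = b * pairNM G n m"
    and pairNM_right: "pairNM G n (actMB G m b) = pairNM G n m * b"
    and MNM_assoc: "actAM G (pairMN G m n) m' = actMB G m (pairNM G n m')"
    and NMN_assoc: "actBN G (pairNM G n m) n' = actNA G n (pairMN G m n')"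

locale generalized_matrix_algebra = morita_context G
  for G :: "('r::comm_ring_1, 'a::ring_1, 'b::ring_1,
             'm::ab_group_add, 'n::ab_group_add) morita_data" +
  assumes nontrivial: "(\<exists>m::'m. m \<noteq> 0) \<or> (\<exists>n::'n. n \<noteq> 0)"

text \<open>
  The tuple \<open>(a, m, n, b)\<close> stands for the matrix with rows \<open>(a, m)\<close> and \<open>(n, b)\<close>.
  Matrices are added by the componentwise addition of tuples.
\<close>

type_synonym ('a, 'b, 'm, 'n) gmat = "'a \<times> 'm \<times> 'n \<times> 'b"

definition gma_scale ::
  "('r, 'a, 'b, 'm, 'n) morita_data \<Rightarrow> 'r \<Rightarrow> ('a, 'b, 'm, 'n) gmat \<Rightarrow> ('a, 'b, 'm, 'n) gmat" where
  "gma_scale G r = (\<lambda>(a, m, n, b). (scaleA G r a, scaleM G r m, scaleN G r n, scaleB G r b))"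

definition gma_mult ::
  "('r, 'a::ring_1, 'b::ring_1, 'm::ab_group_add, 'n::ab_group_add) morita_data \<Rightarrow>
   ('a, 'b, 'm, 'n) gmat \<Rightarrow> ('a, 'b, 'm, 'n) gmat \<Rightarrow> ('a, 'b, 'm, 'n) gmat" where
  "gma_mult G = (\<lambda>(a, m, n, b) (a', m', n', b').
     (a * a' + pairMN G m n',      actAM G a m' + actMB G m b',
      actNA G n a' + actBN G b n', pairNM G n m' + b * b'))"

definition gma_diag :: "'a \<Rightarrow> 'b \<Rightarrow> ('a, 'b, 'm::zero, 'n::zero) gmat" (infix \<open>\<oplus>\<^sub>G\<close> 60) where
  "a \<oplus>\<^sub>G b = (a, 0, 0, b)"

definition proj_A :: "('a, 'b, 'm, 'n) gmat \<Rightarrow> 'a" where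
  "proj_A = (\<lambda>(a, m, n, b). a)"

definition proj_B :: "('a, 'b, 'm, 'n) gmat \<Rightarrow> 'b" where
  "proj_B = (\<lambda>(a, m, n, b). b)"

definition gma_center ::
  "('r, 'a::ring_1, 'b::ring_1, 'm::ab_group_add, 'n::ab_group_add) morita_data \<Rightarrow>
   ('a, 'b, 'm, 'n) gmat set" where
  "gma_center G = center (gma_mult G)"

definition faithful_M ::
  "('r, 'a::zero, 'b::zero, 'm::zero, 'n) morita_data \<Rightarrow> bool" where
  "faithful_M G \<longleftrightarrow>
     (\<forall>a. (\<forall>m. actAM G a m = 0) \<longrightarrow> a = 0) \<and> (\<forall>b. (\<forall>m. actMB G m b = 0) \<longrightarrow> b = 0)"

definition two_torsion_free :: "'m::ab_group_add itself \<Rightarrow> bool" where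
  "two_torsion_free _ \<longleftrightarrow> (\<forall>m::'m. m + m = 0 \<longrightarrow> m = 0)"

context morita_context
begin

lemmas zero_simps [simp] =
  M.lact_add_left [of 0 0, simplified] M.lact_add_right [of _ 0 0, simplified]
  M.ract_add_left [of 0 0, simplified] M.ract_add_right [of _ 0 0, simplified]
  N.lact_add_left [of 0 0, simplified] N.lact_add_right [of _ 0 0, simplified]
  N.ract_add_left [of 0 0, simplified] N.ract_add_right [of _ 0 0, simplified]
  pairMN_add_left [of 0 0, simplified] pairMN_add_right [of _ 0 0, simplified]
  pairNM_add_left [of 0 0, simplified] pairNM_add_right [of _ 0 0, simplified]

lemma pair_scale:
  "pairMN G (scaleM G r m) n = scaleA G r (pairMN G m n)"
  "pairMN G m (scaleN G r n) = scaleA G r (pairMN G m n)"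
  "pairNM G (scaleN G r n) m = scaleB G r (pairNM G n m)"
  "pairNM G n (scaleM G r m) = scaleB G r (pairNM G n m)"
  by (metis M.A.mul_scale_left M.lact_one M.lact_scale_left mult_1 pairMN_left,
      metis M.A.mul_scale_right N.ract_one N.ract_scale_right mult_1_right pairMN_right,
      metis M.B.mul_scale_left N.lact_one N.lact_scale_left mult_1 pairNM_left,
      metis M.B.mul_scale_right M.ract_one M.ract_scale_right mult_1_right pairNM_right)

lemma unital_algebra_gma:
  "unital_algebra (gma_scale G) (gma_mult G) (1 \<oplus>\<^sub>G 1)"
  by unfold_locales
    (auto simp: gma_scale_def gma_mult_def gma_diag_def split_paired_all
      M.scale_right_distrib M.scale_left_distrib N.scale_right_distrib N.scale_left_distrib
      M.A.scale_right_distrib M.A.scale_left_distrib M.B.scale_right_distrib M.B.scale_left_distrib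
      distrib_left distrib_right mult.assoc
      M.lact_add_left M.lact_add_right M.ract_add_left M.ract_add_right
      N.lact_add_left N.lact_add_right N.ract_add_left N.ract_add_right
      M.lact_assoc M.ract_assoc M.lact_ract N.lact_assoc N.ract_assoc N.lact_ract
      M.lact_one M.ract_one N.lact_one N.ract_one
      M.A.mul_scale_left M.A.mul_scale_right M.B.mul_scale_left M.B.mul_scale_right
      M.lact_scale_left M.lact_scale_right M.ract_scale_left M.ract_scale_right
      N.lact_scale_left N.lact_scale_right N.ract_scale_left N.ract_scale_right
      pairMN_add_left pairMN_add_right pairMN_balanced pairMN_left pairMN_right
      pairNM_add_left pairNM_add_right pairNM_balanced pairNM_left pairNM_right
      MNM_assoc NMN_assoc pair_scale)

lemma gma_center_eq:
  "gma_center G = {a \<oplus>\<^sub>G b | a b. a \<in> center (*) \<and> b \<in> center (*) \<and>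
     (\<forall>m. actAM G a m = actMB G m b) \<and> (\<forall>n. actNA G n a = actBN G b n)}" (is "_ = ?Z")
proof
  show "gma_center G \<subseteq> ?Z"
  proof
    fix z assume "z \<in> gma_center G"
    moreover obtain a m n b where z: "z = (a, m, n, b)" by (cases z)
    ultimately have c: "gma_mult G (a, m, n, b) x = gma_mult G x (a, m, n, b)" for x
      by (simp add: gma_center_def center_def del: split_paired_All)
    have "m = 0" "n = 0"
      using c [of "(1, 0, 0, 0)"] by (simp_all add: gma_mult_def M.lact_one N.ract_one)
    moreover have "a * a' = a' * a" for a'
      using c [of "(a', 0, 0, 0)"] by (simp add: gma_mult_def)
    moreover have "b * b' = b' * b" for b'
      using c [of "(0, 0, 0, b')"] by (simp add: gma_mult_def)
    moreover have "actAM G a m' = actMB G m' b" for m'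
      using c [of "(0, m', 0, 0)"] by (simp add: gma_mult_def)
    moreover have "actNA G n' a = actBN G b n'" for n'
      using c [of "(0, 0, n', 0)"] by (simp add: gma_mult_def)
    ultimately show "z \<in> ?Z"
      by (auto simp: z gma_diag_def center_def)
  qed
  show "?Z \<subseteq> gma_center G"
    by (auto simp: gma_center_def center_def gma_mult_def gma_diag_def)
qed

end


section \<open>The standard presentation of a Lie derivation\<close>

definition standard_presentation ::
  "('r::comm_ring_1, 'a::ring_1, 'b::ring_1, 'm::ab_group_add, 'n::ab_group_add) morita_data \<Rightarrow>
   (('a, 'b, 'm, 'n) gmat \<Rightarrow> ('a, 'b, 'm, 'n) gmat) \<Rightarrow>
   'm \<Rightarrow> 'n \<Rightarrow> ('a \<Rightarrow> 'a) \<Rightarrow> ('b \<Rightarrow> 'b) \<Rightarrow> ('m \<Rightarrow> 'm) \<Rightarrow> ('n \<Rightarrow> 'n) \<Rightarrow>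
   ('a \<Rightarrow> 'b) \<Rightarrow> ('b \<Rightarrow> 'a) \<Rightarrow> bool" where
  "standard_presentation G L m\<^sub>0 n\<^sub>0 P Q f g h\<^sub>A h\<^sub>B \<longleftrightarrow>
    (\<forall>a m n b. L (a, m, n, b) =
       (P a - pairMN G m n\<^sub>0 - pairMN G m\<^sub>0 n + h\<^sub>B b,
        actAM G a m\<^sub>0 - actMB G m\<^sub>0 b + f m,
        actNA G n\<^sub>0 a - actBN G b n\<^sub>0 + g n,
        h\<^sub>A a + pairNM G n\<^sub>0 m + pairNM G n m\<^sub>0 + Q b)) \<and>
    module_hom (scaleM G) (scaleM G) f \<and> module_hom (scaleN G) (scaleN G) g \<and>
    module_hom (scaleB G) (scaleA G) h\<^sub>B \<and> range h\<^sub>B \<subseteq> center (*) \<and>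
    module_hom (scaleA G) (scaleB G) h\<^sub>A \<and> range h\<^sub>A \<subseteq> center (*) \<and>
    lie_derivation (scaleA G) (*) P \<and> lie_derivation (scaleB G) (*) Q \<and>
    (\<forall>b b'. h\<^sub>B (commutator (*) b b') = 0) \<and> (\<forall>a a'. h\<^sub>A (commutator (*) a a') = 0) \<and>
    (\<forall>a m. f (actAM G a m) = actAM G (P a) m - actMB G m (h\<^sub>A a) + actAM G a (f m)) \<and>
    (\<forall>m b. f (actMB G m b) = actMB G m (Q b) - actAM G (h\<^sub>B b) m + actMB G (f m) b) \<and>
    (\<forall>n a. g (actNA G n a) = actNA G n (P a) - actBN G (h\<^sub>A a) n + actNA G (g n) a) \<and>
    (\<forall>b n. g (actBN G b n) = actBN G (Q b) n - actNA G n (h\<^sub>B b) + actBN G b (g n)) \<and>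
    (\<forall>m n. P (pairMN G m n) - h\<^sub>B (pairNM G n m) = pairMN G m (g n) + pairMN G (f m) n) \<and>
    (\<forall>m n. Q (pairNM G n m) - h\<^sub>A (pairMN G m n) = pairNM G (g n) m + pairNM G n (f m))"

end

theory Submission
  imports Defs
begin

text \<open>
  \<^emph>\<open>Necessity.\<close> Write \<open>L = D + \<tau>\<close>. The values of \<open>\<tau>\<close> are diagonal, so only the diagonal
  corners of \<open>D\<close> and \<open>L\<close> differ. Multiplying by the idempotents \<open>1 \<oplus> 0\<close> and \<open>0 \<oplus> 1\<close> shows that
  a derivation maps \<open>a \<oplus> 0\<close> to a matrix with zero lower right corner and \<open>0 \<oplus> b\<close> to one with zero
  upper left corner (\<open>derivation_corner_B\<close>, \<open>derivation_corner_A\<close>). Hence \<open>h\<^sub>A a\<close> is the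
  lower right corner of the central element \<open>\<tau> (a \<oplus> 0)\<close>, and \<open>h\<^sub>B b\<close> is the upper left corner of
  \<open>\<tau> (0 \<oplus> b)\<close>. Applying the Leibniz rule to the product \<open>mn \<oplus> 0\<close> of the off-diagonal matrices
  given by \<open>m\<close> and \<open>n\<close>, and comparing with the formula for
  \<open>P (mn) - h\<^sub>B (nm)\<close> in the presentation, identifies the upper left corner of
  \<open>\<tau> (mn \<oplus> 0)\<close> with \<open>h\<^sub>B (nm)\<close>. So \<open>h\<^sub>B (nm) \<oplus> h\<^sub>A (mn) = \<tau> (mn \<oplus> 0)\<close> is central.

  \<^emph>\<open>Sufficiency.\<close> When \<open>M\<close> is faithful, each corner of a central element determines the other.
  The range conditions therefore yield unique linear maps \<open>l\<^sub>A\<close>, \<open>l\<^sub>B\<close> with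
  \<open>l\<^sub>A a \<oplus> h\<^sub>A a\<close> and \<open>h\<^sub>B b \<oplus> l\<^sub>B b\<close> central (\<open>linear_central_lift_A\<close>,
  \<open>linear_central_lift_B\<close>), and the last condition says \<open>l\<^sub>A (mn) = h\<^sub>B (nm)\<close> and
  \<open>l\<^sub>B (nm) = h\<^sub>A (mn)\<close>. Subtracting
  \<open>\<tau> (a, m, n, b) = (l\<^sub>A a \<oplus> h\<^sub>A a) + (h\<^sub>B b \<oplus> l\<^sub>B b)\<close> from \<open>L\<close> replaces \<open>P\<close> by \<open>P - l\<^sub>A\<close>
  and \<open>Q\<close> by \<open>Q - l\<^sub>B\<close> and removes \<open>h\<^sub>A\<close> and \<open>h\<^sub>B\<close> from all the identities of the
  presentation. What remains are the identities that make a map of this shape a derivation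
  (\<open>derivation_of_components\<close>); the Leibniz rule for \<open>P - l\<^sub>A\<close> and \<open>Q - l\<^sub>B\<close> follows from
  the rules for \<open>f (am)\<close> and \<open>f (mb)\<close> by faithfulness.
\<close>

section \<open>Centers\<close>

context unital_algebra
begin

lemma center_add: "x \<in> center mul \<Longrightarrow> y \<in> center mul \<Longrightarrow> x + y \<in> center mul"
  by (simp add: center_def mul_add_left mul_add_right)

lemma center_scale: "x \<in> center mul \<Longrightarrow> scale r x \<in> center mul"
  by (simp add: center_def mul_scale_left mul_scale_right)

end

context morita_context
begin

lemma act_diff:
  "actAM G (a - a') m = actAM G a m - actAM G a' m"
  "actAM G a (m - m') = actAM G a m - actAM G a m'"
  "actMB G (m - m') b = actMB G m b - actMB G m' b"
  "actMB G m (b - b') = actMB G m b - actMB G m b'"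
  "actBN G (b - b') n = actBN G b n - actBN G b' n"
  "actBN G b (n - n') = actBN G b n - actBN G b n'"
  "actNA G (n - n') a = actNA G n a - actNA G n' a"
  "actNA G n (a - a') = actNA G n a - actNA G n a'"
  by (simp_all add: eq_diff_eq flip: M.lact_add_left M.lact_add_right M.ract_add_left
      M.ract_add_right N.lact_add_left N.lact_add_right N.ract_add_left N.ract_add_right)

lemma pair_diff:
  "pairMN G (m - m') n = pairMN G m n - pairMN G m' n"
  "pairMN G m (n - n') = pairMN G m n - pairMN G m n'"
  "pairNM G (n - n') m = pairNM G n m - pairNM G n' m"
  "pairNM G n (m - m') = pairNM G n m - pairNM G n m'"
  by (simp_all add: eq_diff_eq flip: pairMN_add_left pairMN_add_right
      pairNM_add_left pairNM_add_right)

lemmas expand_simps =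
  act_diff pair_diff distrib_left distrib_right left_diff_distrib right_diff_distrib mult.assoc
  M.lact_add_left M.lact_add_right M.ract_add_left M.ract_add_right
  N.lact_add_left N.lact_add_right N.ract_add_left N.ract_add_right
  M.lact_assoc M.ract_assoc M.lact_ract N.lact_assoc N.ract_assoc N.lact_ract
  pairMN_add_left pairMN_add_right pairMN_balanced pairMN_left pairMN_right
  pairNM_add_left pairNM_add_right pairNM_balanced pairNM_left pairNM_right
  MNM_assoc NMN_assoc

lemma diag_central_iff:
  "a \<oplus>\<^sub>G b \<in> gma_center G \<longleftrightarrow> a \<in> center (*) \<and> b \<in> center (*) \<and>
     (\<forall>m. actAM G a m = actMB G m b) \<and> (\<forall>n. actNA G n a = actBN G b n)"
  by (auto simp: gma_center_eq) (auto simp: gma_diag_def)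

lemma gma_centerE:
  assumes "z \<in> gma_center G"
  obtains a b where "z = (a, 0, 0, b)" "a \<oplus>\<^sub>G b \<in> gma_center G"
  using assms by (auto simp: gma_center_eq gma_diag_def)

lemma diag_central_add:
  assumes "a \<oplus>\<^sub>G b \<in> gma_center G" "a' \<oplus>\<^sub>G b' \<in> gma_center G"
  shows "(a + a') \<oplus>\<^sub>G (b + b') \<in> gma_center G"
  using unital_algebra.center_add [OF unital_algebra_gma] assms
  by (force simp: gma_center_def gma_diag_def)

lemma diag_central_scale:
  assumes "a \<oplus>\<^sub>G b \<in> gma_center G"
  shows "scaleA G r a \<oplus>\<^sub>G scaleB G r b \<in> gma_center G"
  using unital_algebra.center_scale [OF unital_algebra_gma, of _ r] assms
  by (force simp: gma_center_def gma_diag_def gma_scale_def)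

lemma range_subset_proj_iff:
  "range h \<subseteq> proj_B ` gma_center G \<longleftrightarrow> (\<forall>a. \<exists>a'. a' \<oplus>\<^sub>G h a \<in> gma_center G)"
  "range k \<subseteq> proj_A ` gma_center G \<longleftrightarrow> (\<forall>b. \<exists>b'. k b \<oplus>\<^sub>G b' \<in> gma_center G)"
proof -
  have B: "b \<in> proj_B ` gma_center G \<longleftrightarrow> (\<exists>a'. a' \<oplus>\<^sub>G b \<in> gma_center G)" for b
  proof
    assume "b \<in> proj_B ` gma_center G"
    then obtain z where z: "z \<in> gma_center G" and b: "b = proj_B z"
      by blast
    from z show "\<exists>a'. a' \<oplus>\<^sub>G b \<in> gma_center G"
      by (rule gma_centerE) (auto simp: proj_B_def b)
  next
    assume "\<exists>a'. a' \<oplus>\<^sub>G b \<in> gma_center G"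
    then obtain a' where "a' \<oplus>\<^sub>G b \<in> gma_center G"
      by blast
    moreover have "b = proj_B (a' \<oplus>\<^sub>G b :: ('a, 'b, 'm, 'n) gmat)"
      by (simp add: proj_B_def gma_diag_def)
    ultimately show "b \<in> proj_B ` gma_center G"
      by blast
  qed
  have A: "a \<in> proj_A ` gma_center G \<longleftrightarrow> (\<exists>b'. a \<oplus>\<^sub>G b' \<in> gma_center G)" for a
  proof
    assume "a \<in> proj_A ` gma_center G"
    then obtain z where z: "z \<in> gma_center G" and a: "a = proj_A z"
      by blast
    from z show "\<exists>b'. a \<oplus>\<^sub>G b' \<in> gma_center G"
      by (rule gma_centerE) (auto simp: proj_A_def a)
  next
    assume "\<exists>b'. a \<oplus>\<^sub>G b' \<in> gma_center G"
    then obtain b' where "a \<oplus>\<^sub>G b' \<in> gma_center G"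
      by blast
    moreover have "a = proj_A (a \<oplus>\<^sub>G b' :: ('a, 'b, 'm, 'n) gmat)"
      by (simp add: proj_A_def gma_diag_def)
    ultimately show "a \<in> proj_A ` gma_center G"
      by blast
  qed
  show "range h \<subseteq> proj_B ` gma_center G \<longleftrightarrow> (\<forall>a. \<exists>a'. a' \<oplus>\<^sub>G h a \<in> gma_center G)"
    by (simp add: image_subset_iff B)
  show "range k \<subseteq> proj_A ` gma_center G \<longleftrightarrow> (\<forall>b. \<exists>b'. k b \<oplus>\<^sub>G b' \<in> gma_center G)"
    by (simp add: image_subset_iff A)
qed

lemma faithful_eqA:
  assumes "faithful_M G" "\<And>m. actAM G a m = actAM G a' m"
  shows "a = a'"
proof -
  have "\<forall>m. actAM G (a - a') m = 0"
    using assms(2) by (simp add: act_diff)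
  then show ?thesis
    using assms(1) unfolding faithful_M_def by (metis eq_iff_diff_eq_0)
qed

lemma faithful_eqB:
  assumes "faithful_M G" "\<And>m. actMB G m b = actMB G m b'"
  shows "b = b'"
proof -
  have "\<forall>m. actMB G m (b - b') = 0"
    using assms(2) by (simp add: act_diff)
  then show ?thesis
    using assms(1) unfolding faithful_M_def by (metis eq_iff_diff_eq_0)
qed

lemma central_unique_A:
  assumes "faithful_M G" "a \<oplus>\<^sub>G b \<in> gma_center G" "a' \<oplus>\<^sub>G b \<in> gma_center G"
  shows "a = a'"
  using assms by (intro faithful_eqA) (auto simp: diag_central_iff)

lemma central_unique_B:
  assumes "faithful_M G" "a \<oplus>\<^sub>G b \<in> gma_center G" "a \<oplus>\<^sub>G b' \<in> gma_center G"
  shows "b = b'"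
  using assms by (intro faithful_eqB) (auto simp: diag_central_iff)

text \<open>The preimages of \<open>h a\<close> under the projection of the center can be chosen linearly in \<open>a\<close>,
  because faithfulness of \<open>M\<close> leaves no choice.\<close>

lemma linear_central_lift_A:
  assumes F: "faithful_M G" and h: "module_hom (scaleA G) (scaleB G) h"
    and r: "range h \<subseteq> proj_B ` gma_center G"
  obtains l where "module_hom (scaleA G) (scaleA G) l" "\<And>a. l a \<oplus>\<^sub>G h a \<in> gma_center G"
proof -
  obtain l where l: "\<And>a. l a \<oplus>\<^sub>G h a \<in> gma_center G"
    using r unfolding range_subset_proj_iff by metis
  have "l (a + a') = l a + l a'" for a a'
    using diag_central_add [OF l [of a] l [of a']]
    by (intro central_unique_A [OF F l]) (simp add: module_hom.add [OF h])
  moreover have "l (scaleA G r a) = scaleA G r (l a)" for r a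
    using diag_central_scale [OF l [of a], of r]
    by (intro central_unique_A [OF F l]) (simp add: module_hom.scale [OF h])
  ultimately have "module_hom (scaleA G) (scaleA G) l"
    by (simp add: module_hom_iff M.A.module_axioms)
  then show thesis
    using l that by blast
qed

lemma linear_central_lift_B:
  assumes F: "faithful_M G" and h: "module_hom (scaleB G) (scaleA G) h"
    and r: "range h \<subseteq> proj_A ` gma_center G"
  obtains l where "module_hom (scaleB G) (scaleB G) l" "\<And>b. h b \<oplus>\<^sub>G l b \<in> gma_center G"
proof -
  obtain l where l: "\<And>b. h b \<oplus>\<^sub>G l b \<in> gma_center G"
    using r unfolding range_subset_proj_iff by metis
  have "l (b + b') = l b + l b'" for b b'
    using diag_central_add [OF l [of b] l [of b']]
    by (intro central_unique_B [OF F l]) (simp add: module_hom.add [OF h])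
  moreover have "l (scaleB G r b) = scaleB G r (l b)" for r b
    using diag_central_scale [OF l [of b], of r]
    by (intro central_unique_B [OF F l]) (simp add: module_hom.scale [OF h])
  ultimately have "module_hom (scaleB G) (scaleB G) l"
    by (simp add: module_hom_iff M.B.module_axioms)
  then show thesis
    using l that by blast
qed


section \<open>Derivations of a generalized matrix algebra\<close>

text \<open>The Leibniz rule for \<open>x = x (1 \<oplus> 0)\<close> with \<open>x = a \<oplus> 0\<close>: both \<open>D x (1 \<oplus> 0)\<close>
  and \<open>x D (1 \<oplus> 0)\<close> have lower right corner zero.\<close>

lemma derivation_corner_B:
  assumes "derivation (gma_scale G) (gma_mult G) D" and "D (a, 0, 0, 0) = (a', m, n, b)"
  shows "b = 0"
proof -
  obtain a1 m1 n1 b1 where e: "D (1, 0, 0, 0) = (a1, m1, n1, b1)"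
    by (cases "D (1, 0, 0, 0)")
  have "D (gma_mult G (a, 0, 0, 0) (1, 0, 0, 0)) =
      gma_mult G (D (a, 0, 0, 0)) (1, 0, 0, 0) + gma_mult G (a, 0, 0, 0) (D (1, 0, 0, 0))"
    using assms(1) by (simp add: derivation_def del: split_paired_All)
  then show ?thesis
    by (simp add: assms(2) e gma_mult_def)
qed

lemma derivation_corner_A:
  assumes "derivation (gma_scale G) (gma_mult G) D" and "D (0, 0, 0, b) = (a, m, n, b')"
  shows "a = 0"
proof -
  obtain a1 m1 n1 b1 where e: "D (0, 0, 0, 1) = (a1, m1, n1, b1)"
    by (cases "D (0, 0, 0, 1)")
  have "D (gma_mult G (0, 0, 0, b) (0, 0, 0, 1)) =
      gma_mult G (D (0, 0, 0, b)) (0, 0, 0, 1) + gma_mult G (0, 0, 0, b) (D (0, 0, 0, 1))"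
    using assms(1) by (simp add: derivation_def del: split_paired_All)
  then show ?thesis
    by (simp add: assms(2) e gma_mult_def)
qed

text \<open>The standard presentation with \<open>h\<^sub>A = h\<^sub>B = 0\<close>: if moreover \<open>P\<close> and \<open>Q\<close> are
  derivations, then the presented map is one.\<close>

lemma derivation_of_components:
  assumes hom: "module_hom (gma_scale G) (gma_scale G) D"
    and D: "\<And>a m n b. D (a, m, n, b) =
       (P a - pairMN G m n\<^sub>0 - pairMN G m\<^sub>0 n,
        actAM G a m\<^sub>0 - actMB G m\<^sub>0 b + f m,
        actNA G n\<^sub>0 a - actBN G b n\<^sub>0 + g n,
        pairNM G n\<^sub>0 m + pairNM G n m\<^sub>0 + Q b)"
    and add: "\<And>a a'. P (a + a') = P a + P a'" "\<And>b b'. Q (b + b') = Q b + Q b'"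
      "\<And>m m'. f (m + m') = f m + f m'" "\<And>n n'. g (n + n') = g n + g n'"
    and mult: "\<And>a a'. P (a * a') = P a * a' + a * P a'"
      "\<And>b b'. Q (b * b') = Q b * b' + b * Q b'"
    and act: "\<And>a m. f (actAM G a m) = actAM G (P a) m + actAM G a (f m)"
      "\<And>m b. f (actMB G m b) = actMB G (f m) b + actMB G m (Q b)"
      "\<And>n a. g (actNA G n a) = actNA G (g n) a + actNA G n (P a)"
      "\<And>b n. g (actBN G b n) = actBN G (Q b) n + actBN G b (g n)"
    and pair: "\<And>m n. P (pairMN G m n) = pairMN G (f m) n + pairMN G m (g n)"
      "\<And>n m. Q (pairNM G n m) = pairNM G (g n) m + pairNM G n (f m)"
  shows "derivation (gma_scale G) (gma_mult G) D"
  unfolding derivation_def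
proof (intro conjI allI)
  show "D (gma_mult G x y) = gma_mult G (D x) y + gma_mult G x (D y)" for x y
    by (cases x, cases y) (simp add: gma_mult_def D add mult act pair expand_simps)
qed (rule hom)

end


section \<open>Proper Lie derivations\<close>

text \<open>A Lie derivation of the generalized matrix algebra of a Morita context, with a fixed standard
  presentation.\<close>

locale presented_lie_derivation = morita_context G
  for G :: "('r::comm_ring_1, 'a::ring_1, 'b::ring_1,
             'm::ab_group_add, 'n::ab_group_add) morita_data" +
  fixes L :: "('a, 'b, 'm, 'n) gmat \<Rightarrow> ('a, 'b, 'm, 'n) gmat"
    and m\<^sub>0 :: 'm and n\<^sub>0 :: 'n
    and P :: "'a \<Rightarrow> 'a" and Q :: "'b \<Rightarrow> 'b" and f :: "'m \<Rightarrow> 'm" and g :: "'n \<Rightarrow> 'n"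
    and h\<^sub>A :: "'a \<Rightarrow> 'b" and h\<^sub>B :: "'b \<Rightarrow> 'a"
  assumes lie: "lie_derivation (gma_scale G) (gma_mult G) L"
    and presentation: "standard_presentation G L m\<^sub>0 n\<^sub>0 P Q f g h\<^sub>A h\<^sub>B"
begin

lemma L_eq: "L (a, m, n, b) =
   (P a - pairMN G m n\<^sub>0 - pairMN G m\<^sub>0 n + h\<^sub>B b,
    actAM G a m\<^sub>0 - actMB G m\<^sub>0 b + f m,
    actNA G n\<^sub>0 a - actBN G b n\<^sub>0 + g n,
    h\<^sub>A a + pairNM G n\<^sub>0 m + pairNM G n m\<^sub>0 + Q b)"
  using presentation by (simp add: standard_presentation_def)

lemma hom:
  "module_hom (scaleA G) (scaleA G) P" "module_hom (scaleB G) (scaleB G) Q"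
  "module_hom (scaleM G) (scaleM G) f" "module_hom (scaleN G) (scaleN G) g"
  "module_hom (scaleA G) (scaleB G) h\<^sub>A" "module_hom (scaleB G) (scaleA G) h\<^sub>B"
  using presentation by (simp_all add: standard_presentation_def lie_derivation_def)

lemmas hom_add = hom [THEN module_hom.add]
lemmas hom_zero [simp] = hom [THEN module_hom.zero]

lemma f_act:
  "f (actAM G a m) = actAM G (P a) m - actMB G m (h\<^sub>A a) + actAM G a (f m)"
  "f (actMB G m b) = actMB G m (Q b) - actAM G (h\<^sub>B b) m + actMB G (f m) b"
  using presentation by (simp_all add: standard_presentation_def)

lemma g_act:
  "g (actNA G n a) = actNA G n (P a) - actBN G (h\<^sub>A a) n + actNA G (g n) a"
  "g (actBN G b n) = actBN G (Q b) n - actNA G n (h\<^sub>B b) + actBN G b (g n)"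
  using presentation by (simp_all add: standard_presentation_def)

lemma PQ_pair:
  "P (pairMN G m n) - h\<^sub>B (pairNM G n m) = pairMN G m (g n) + pairMN G (f m) n"
  "Q (pairNM G n m) - h\<^sub>A (pairMN G m n) = pairNM G (g n) m + pairNM G n (f m)"
  using presentation by (simp_all add: standard_presentation_def)

lemma proper_imp_conditions:
  assumes "proper_lie_derivation (gma_scale G) (gma_mult G) L"
  shows "range h\<^sub>A \<subseteq> proj_B ` gma_center G" "range h\<^sub>B \<subseteq> proj_A ` gma_center G"
    and "h\<^sub>B (pairNM G n m) \<oplus>\<^sub>G h\<^sub>A (pairMN G m n) \<in> gma_center G"
proof -
  obtain D \<tau> where der: "derivation (gma_scale G) (gma_mult G) D"
    and \<tau>: "range \<tau> \<subseteq> center (gma_mult G)" and "\<And>x. L x = D x + \<tau> x"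
    using assms unfolding proper_lie_derivation_def by blast
  then have D: "D x = L x - \<tau> x" for x
    by (simp add: eq_diff_eq)
  define \<alpha> \<beta> where "\<alpha> x = proj_A (\<tau> x)" and "\<beta> x = proj_B (\<tau> x)" for x
  have *: "\<tau> x = (\<alpha> x, 0, 0, \<beta> x) \<and> \<alpha> x \<oplus>\<^sub>G \<beta> x \<in> gma_center G" for x
  proof -
    have "\<tau> x \<in> gma_center G"
      using \<tau> by (auto simp: gma_center_def)
    then show ?thesis
      by (rule gma_centerE) (simp add: \<alpha>_def \<beta>_def proj_A_def proj_B_def)
  qed
  then have \<tau>_eq: "\<tau> x = (\<alpha> x, 0, 0, \<beta> x)" and central: "\<alpha> x \<oplus>\<^sub>G \<beta> x \<in> gma_center G" for x
    by blast+
  have \<beta>: "\<beta> (a, 0, 0, 0) = h\<^sub>A a" for a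
    using derivation_corner_B [OF der, of a] by (simp add: D L_eq \<tau>_eq)
  have \<alpha>: "\<alpha> (0, 0, 0, b) = h\<^sub>B b" for b
    using derivation_corner_A [OF der, of b] by (simp add: D L_eq \<tau>_eq)
  show "range h\<^sub>A \<subseteq> proj_B ` gma_center G"
    unfolding range_subset_proj_iff using central \<beta> by metis
  show "range h\<^sub>B \<subseteq> proj_A ` gma_center G"
    unfolding range_subset_proj_iff using central \<alpha> by metis
  \<comment> \<open>The product of these two matrices is \<open>mn \<oplus> 0\<close>.\<close>
  have "D (gma_mult G (0, m, 0, 0) (0, 0, n, 0)) =
      gma_mult G (D (0, m, 0, 0)) (0, 0, n, 0) + gma_mult G (0, m, 0, 0) (D (0, 0, n, 0))"
    using der by (simp add: derivation_def del: split_paired_All)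
  then have "P (pairMN G m n) - \<alpha> (pairMN G m n, 0, 0, 0) = pairMN G (f m) n + pairMN G m (g n)"
    by (simp add: D L_eq \<tau>_eq gma_mult_def)
  also have "\<dots> = P (pairMN G m n) - h\<^sub>B (pairNM G n m)"
    by (simp add: PQ_pair)
  finally have "\<alpha> (pairMN G m n, 0, 0, 0) = h\<^sub>B (pairNM G n m)"
    by simp
  then show "h\<^sub>B (pairNM G n m) \<oplus>\<^sub>G h\<^sub>A (pairMN G m n) \<in> gma_center G"
    using central \<beta> by metis
qed

lemma conditions_imp_proper:
  assumes F: "faithful_M G"
    and rA: "range h\<^sub>A \<subseteq> proj_B ` gma_center G" and rB: "range h\<^sub>B \<subseteq> proj_A ` gma_center G"
    and mn: "\<And>m n. h\<^sub>B (pairNM G n m) \<oplus>\<^sub>G h\<^sub>A (pairMN G m n) \<in> gma_center G"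
  shows "proper_lie_derivation (gma_scale G) (gma_mult G) L"
proof -
  obtain l\<^sub>A where lA: "module_hom (scaleA G) (scaleA G) l\<^sub>A"
    and cA: "\<And>a. l\<^sub>A a \<oplus>\<^sub>G h\<^sub>A a \<in> gma_center G"
    using linear_central_lift_A [OF F hom(5) rA] by blast
  obtain l\<^sub>B where lB: "module_hom (scaleB G) (scaleB G) l\<^sub>B"
    and cB: "\<And>b. h\<^sub>B b \<oplus>\<^sub>G l\<^sub>B b \<in> gma_center G"
    using linear_central_lift_B [OF F hom(6) rB] by blast
  have l_pair: "l\<^sub>A (pairMN G m n) = h\<^sub>B (pairNM G n m)" "l\<^sub>B (pairNM G n m) = h\<^sub>A (pairMN G m n)"
    for m n
    using central_unique_A [OF F cA mn] central_unique_B [OF F cB mn] by blast+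
  define \<tau> where "\<tau> = (\<lambda>(a, m :: 'm, n :: 'n, b). (l\<^sub>A a + h\<^sub>B b) \<oplus>\<^sub>G (h\<^sub>A a + l\<^sub>B b)
    :: ('a, 'b, 'm, 'n) gmat)"
  define D where "D x = L x - \<tau> x" for x
  define P' where "P' a = P a - l\<^sub>A a" for a
  define Q' where "Q' b = Q b - l\<^sub>B b" for b
  have mod: "module (gma_scale G)"
    using unital_algebra_gma by (simp add: unital_algebra_def)
  have \<tau>_hom: "module_hom (gma_scale G) (gma_scale G) \<tau>"
    by (auto simp: module_hom_iff mod \<tau>_def gma_diag_def gma_scale_def hom_add
        hom [THEN module_hom.scale] module_hom.add [OF lA] module_hom.add [OF lB]
        module_hom.scale [OF lA] module_hom.scale [OF lB]
        M.A.scale_right_distrib M.B.scale_right_distrib)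
  have L_hom: "module_hom (gma_scale G) (gma_scale G) L"
    using lie by (simp add: lie_derivation_def)
  have D_hom: "module_hom (gma_scale G) (gma_scale G) D"
    unfolding D_def using L_hom \<tau>_hom
    by (rule module_pair.module_hom_sub [OF module_pair.intro [OF mod mod]])
  have central: "range \<tau> \<subseteq> center (gma_mult G)"
    using diag_central_add [OF cA cB] by (auto simp: \<tau>_def gma_center_def)
  have f_act': "f (actAM G a m) = actAM G (P' a) m + actAM G a (f m)"
    "f (actMB G m b) = actMB G (f m) b + actMB G m (Q' b)" for a m b
    using cA [of a] cB [of b] by (simp_all add: f_act P'_def Q'_def act_diff diag_central_iff)
  have g_act': "g (actNA G n a) = actNA G (g n) a + actNA G n (P' a)"
    "g (actBN G b n) = actBN G (Q' b) n + actBN G b (g n)" for a n b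
    using cA [of a] cB [of b] by (simp_all add: g_act P'_def Q'_def act_diff diag_central_iff)
  have "derivation (gma_scale G) (gma_mult G) D"
  proof (rule derivation_of_components [OF D_hom])
    \<comment> \<open>Expand \<open>f (a a' m)\<close> in two ways and cancel \<open>m\<close> by faithfulness.\<close>
    show "P' (a * a') = P' a * a' + a * P' a'" for a a'
    proof (rule faithful_eqA [OF F])
      show "actAM G (P' (a * a')) m = actAM G (P' a * a' + a * P' a') m" for m
        using f_act'(1) [of "a * a'" m] by (simp add: f_act' expand_simps)
    qed
    show "Q' (b * b') = Q' b * b' + b * Q' b'" for b b'
    proof (rule faithful_eqB [OF F])
      show "actMB G m (Q' (b * b')) = actMB G m (Q' b * b' + b * Q' b')" for m
        using f_act'(2) [of m "b * b'"] by (simp add: f_act' expand_simps)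
    qed
    show "P' (pairMN G m n) = pairMN G (f m) n + pairMN G m (g n)" for m n
      using PQ_pair(1) [of m n] by (simp add: P'_def l_pair)
    show "Q' (pairNM G n m) = pairNM G (g n) m + pairNM G n (f m)" for m n
      using PQ_pair(2) [of n m] by (simp add: Q'_def l_pair)
    show "D (a, m, n, b) = (P' a - pairMN G m n\<^sub>0 - pairMN G m\<^sub>0 n,
        actAM G a m\<^sub>0 - actMB G m\<^sub>0 b + f m, actNA G n\<^sub>0 a - actBN G b n\<^sub>0 + g n,
        pairNM G n\<^sub>0 m + pairNM G n m\<^sub>0 + Q' b)" for a m n b
      by (simp add: D_def L_eq \<tau>_def gma_diag_def P'_def Q'_def)
  qed (simp_all add: f_act' g_act' hom_add P'_def Q'_def
      module_hom.add [OF lA] module_hom.add [OF lB])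
  moreover have "L x = D x + \<tau> x" for x
    by (simp add: D_def)
  ultimately show ?thesis
    unfolding proper_lie_derivation_def using lie \<tau>_hom central by blast
qed

end

theorem corollary2p4:
  fixes G :: "('r::comm_ring_1, 'a::ring_1, 'b::ring_1,
               'm::ab_group_add, 'n::ab_group_add) morita_data"
    and L :: "('a, 'b, 'm, 'n) gmat \<Rightarrow> ('a, 'b, 'm, 'n) gmat"
    and m\<^sub>0 :: 'm and n\<^sub>0 :: 'n
    and P :: "'a \<Rightarrow> 'a" and Q :: "'b \<Rightarrow> 'b" and f :: "'m \<Rightarrow> 'm" and g :: "'n \<Rightarrow> 'n"
    and h\<^sub>A :: "'a \<Rightarrow> 'b" and h\<^sub>B :: "'b \<Rightarrow> 'a"
  assumes "generalized_matrix_algebra G"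
    and "two_torsion_free TYPE('m)" and "two_torsion_free TYPE('n)"
    and "lie_derivation (gma_scale G) (gma_mult G) L"
    and "standard_presentation G L m\<^sub>0 n\<^sub>0 P Q f g h\<^sub>A h\<^sub>B"
  shows "(proper_lie_derivation (gma_scale G) (gma_mult G) L \<longrightarrow>
            (range h\<^sub>A \<subseteq> proj_B ` gma_center G \<and> range h\<^sub>B \<subseteq> proj_A ` gma_center G) \<and>
            (\<forall>m n. (h\<^sub>B (pairNM G n m) \<oplus>\<^sub>G h\<^sub>A (pairMN G m n)) \<in> gma_center G))
       \<and> (faithful_M G \<longrightarrow>
            (range h\<^sub>A \<subseteq> proj_B ` gma_center G \<and> range h\<^sub>B \<subseteq> proj_A ` gma_center G) \<and>
            (\<forall>m n. (h\<^sub>B (pairNM G n m) \<oplus>\<^sub>G h\<^sub>A (pairMN G m n)) \<in> gma_center G) \<longrightarrow>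
            proper_lie_derivation (gma_scale G) (gma_mult G) L)"
proof -
  interpret generalized_matrix_algebra G by fact
  interpret presented_lie_derivation G L m\<^sub>0 n\<^sub>0 P Q f g h\<^sub>A h\<^sub>B
    by unfold_locales fact+
  show ?thesis
    using proper_imp_conditions conditions_imp_proper by blast
qed

end
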